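(* Let $m,n\ge 2$ be integers. The element $\Delta:=s\,t_1\cdots t_m\,u_1\cdots u_n$ of the monoid $G_{m,n}^{+}$ is a fundamental element; that is, there exists a permutation $\sigma_\Delta$ of the set $L_0=\{s,t_1,\dots,t_m,u_1,\dots,u_n\}$ such that for every $v\in L_0$ there exists $\Delta_v\in G_{m,n}^{+}$ with $\Delta=v\cdot\Delta_v=\Delta_v\cdot\sigma_\Delta(v)$ in $G_{m,n}^{+}$.
   Context: For letters $x_1,\dots,x_k$, the symbol $[x_1,x_2,\dots,x_k]$ denotes the cyclic relations $x_1x_2\cdots x_k=x_2\cdots x_kx_1=x_3\cdots x_kx_1x_2=\cdots=x_kx_1\cdots x_{k-1}$ (all cyclic rotations of the word are equal); in particular $[x,y]$ denotes $xy=yx$. $G_{m,n}^{+}$ is the monoid presented (as a monoid) by the generators $s,t_1,\dots,t_m,u_1,\dots,u_n$ and the relations $[s,t_1,\dots,t_m]$, $[s,u_1,\dots,u_n]$, and $[t_i,u_j]$ for all $1\le i\le m$, $1\le j\le n$. The generators in $L_0$ are exactly the atoms of this monoid. *)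

theory Defs
  imports "HOL-Algebra.Group" "HOL-Combinatorics.Permutations"
begin

section \<open>Monoids given by a presentation\<close>

text \<open>Words are lists over \<open>X\<close>. The relation below is the monoid congruence on the free monoid
  \<open>lists X\<close> generated by \<open>R\<close>; pairs of \<open>R\<close> that are not words over \<open>X\<close> are ignored.\<close>

inductive_set word_cong :: "'a set \<Rightarrow> ('a list \<times> 'a list) set \<Rightarrow> ('a list \<times> 'a list) set"
  for X :: "'a set" and R :: "('a list \<times> 'a list) set" where
  base: "(u, v) \<in> R \<Longrightarrow> u \<in> lists X \<Longrightarrow> v \<in> lists X \<Longrightarrow> (u, v) \<in> word_cong X R"
| refl: "w \<in> lists X \<Longrightarrow> (w, w) \<in> word_cong X R"
| sym: "(u, v) \<in> word_cong X R \<Longrightarrow> (v, u) \<in> word_cong X R"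
| trans: "(u, v) \<in> word_cong X R \<Longrightarrow> (v, w) \<in> word_cong X R \<Longrightarrow> (u, w) \<in> word_cong X R"
| append: "(u, u') \<in> word_cong X R \<Longrightarrow> (v, v') \<in> word_cong X R
    \<Longrightarrow> (u @ v, u' @ v') \<in> word_cong X R"

definition word_class :: "'a set \<Rightarrow> ('a list \<times> 'a list) set \<Rightarrow> 'a list \<Rightarrow> 'a list set" where
  "word_class X R w = word_cong X R `` {w}"

definition presented_monoid :: "'a set \<Rightarrow> ('a list \<times> 'a list) set \<Rightarrow> 'a list set monoid" where
  "presented_monoid X R =
    \<lparr>carrier = lists X // word_cong X R,
     monoid.mult = (\<lambda>A B. \<Union>a\<in>A. \<Union>b\<in>B. word_class X R (a @ b)),
     monoid.one = word_class X R []\<rparr>"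

lemma word_cong_in_lists: "(u, v) \<in> word_cong X R \<Longrightarrow> u \<in> lists X \<and> v \<in> lists X"
  by (induction rule: word_cong.induct) auto

lemma equiv_word_cong: "equiv (lists X) (word_cong X R)"
proof (rule equivI)
  show "word_cong X R \<subseteq> lists X \<times> lists X"
    using word_cong_in_lists by fast
  show "refl_on (lists X) (word_cong X R)"
    by (simp add: refl_on_def word_cong.refl)
  show "sym (word_cong X R)"
    by (rule symI) (rule word_cong.sym)
  show "trans (word_cong X R)"
    by (rule transI) (rule word_cong.trans)
qed

lemma word_class_eq_iff:
  assumes "u \<in> lists X" "v \<in> lists X"
  shows "word_class X R u = word_class X R v \<longleftrightarrow> (u, v) \<in> word_cong X R"
  unfolding word_class_def using equiv_word_cong assms by (rule eq_equiv_class_iff)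

lemma word_class_in_carrier:
  "w \<in> lists X \<Longrightarrow> word_class X R w \<in> carrier (presented_monoid X R)"
  unfolding presented_monoid_def word_class_def by (simp add: quotientI)

lemma carrier_presented_monoidE:
  assumes "A \<in> carrier (presented_monoid X R)"
  obtains w where "w \<in> lists X" "A = word_class X R w"
proof -
  from assms have "A \<in> lists X // word_cong X R"
    by (simp add: presented_monoid_def)
  then show thesis
    by (rule quotientE) (rule that, simp_all add: word_class_def)
qed

lemma mult_word_class:
  assumes "u \<in> lists X" "v \<in> lists X"
  shows "word_class X R u \<otimes>\<^bsub>presented_monoid X R\<^esub> word_class X R v = word_class X R (u @ v)"
proof -
  have "word_class X R (a @ b) = word_class X R (u @ v)"
    if "a \<in> word_class X R u" "b \<in> word_class X R v" for a b
  proof -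
    have "(u @ v, a @ b) \<in> word_cong X R"
      using that by (auto simp: word_class_def intro: word_cong.append)
    moreover from this have "u @ v \<in> lists X" "a @ b \<in> lists X"
      by (auto dest: word_cong_in_lists)
    ultimately show ?thesis
      by (simp only: word_class_eq_iff word_cong.sym)
  qed
  moreover have "u \<in> word_class X R u" "v \<in> word_class X R v"
    using assms by (auto simp: word_class_def intro: word_cong.refl)
  ultimately have "(\<Union>a\<in>word_class X R u. \<Union>b\<in>word_class X R v. word_class X R (a @ b)) =
      word_class X R (u @ v)"
    by blast
  then show ?thesis
    by (simp add: presented_monoid_def)
qed

lemma monoid_presented_monoid: "monoid (presented_monoid X R)"
proof -
  have one: "\<one>\<^bsub>presented_monoid X R\<^esub> = word_class X R []"
    by (simp add: presented_monoid_def)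
  show ?thesis
  proof (rule monoidI)
    fix A B
    assume "A \<in> carrier (presented_monoid X R)" "B \<in> carrier (presented_monoid X R)"
    then show "A \<otimes>\<^bsub>presented_monoid X R\<^esub> B \<in> carrier (presented_monoid X R)"
      by (elim carrier_presented_monoidE) (simp add: mult_word_class word_class_in_carrier)
  next
    fix A B C
    assume "A \<in> carrier (presented_monoid X R)" "B \<in> carrier (presented_monoid X R)"
      "C \<in> carrier (presented_monoid X R)"
    then show "A \<otimes>\<^bsub>presented_monoid X R\<^esub> B \<otimes>\<^bsub>presented_monoid X R\<^esub> C =
        A \<otimes>\<^bsub>presented_monoid X R\<^esub> (B \<otimes>\<^bsub>presented_monoid X R\<^esub> C)"
      by (elim carrier_presented_monoidE) (simp add: mult_word_class)
  next
    fix A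
    assume "A \<in> carrier (presented_monoid X R)"
    then obtain w where w: "w \<in> lists X" "A = word_class X R w"
      by (rule carrier_presented_monoidE)
    show "\<one>\<^bsub>presented_monoid X R\<^esub> \<otimes>\<^bsub>presented_monoid X R\<^esub> A = A"
      using w mult_word_class[of "[]" X w R] by (simp add: one)
    show "A \<otimes>\<^bsub>presented_monoid X R\<^esub> \<one>\<^bsub>presented_monoid X R\<^esub> = A"
      using w mult_word_class[of w X "[]" R] by (simp add: one)
  qed (simp add: one word_class_in_carrier)
qed


section \<open>Fundamental elements\<close>

text \<open>\<open>L\<close> is the distinguished set of generators, as elements of the monoid.\<close>

definition fundamental_element :: "('a, 'b) monoid_scheme \<Rightarrow> 'a set \<Rightarrow> 'a \<Rightarrow> bool" where
  "fundamental_element M L \<Delta> \<longleftrightarrow>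
    \<Delta> \<in> carrier M \<and>
    (\<exists>\<sigma>. \<sigma> permutes L \<and>
      (\<forall>v\<in>L. \<exists>\<Delta>\<^sub>v\<in>carrier M. \<Delta> = v \<otimes>\<^bsub>M\<^esub> \<Delta>\<^sub>v \<and> \<Delta> = \<Delta>\<^sub>v \<otimes>\<^bsub>M\<^esub> \<sigma> v))"


section \<open>The monoid \<open>G\<^sub>m\<^sub>,\<^sub>n\<^sup>+\<close>\<close>

text \<open>The relations \<open>[x\<^sub>1, \<dots>, x\<^sub>k]\<close>: all cyclic rotations of the word are identified.\<close>

definition cyclic_relations :: "'a list \<Rightarrow> ('a list \<times> 'a list) set" where
  "cyclic_relations w = {(rotate i w, rotate j w) | i j. True}"

datatype letter = S | T nat | U nat

definition letters :: "nat \<Rightarrow> nat \<Rightarrow> letter set" where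
  "letters m n = {S} \<union> T ` {1..m} \<union> U ` {1..n}"

definition G_relations :: "nat \<Rightarrow> nat \<Rightarrow> (letter list \<times> letter list) set" where
  "G_relations m n =
    cyclic_relations (S # map T [1..<Suc m]) \<union>
    cyclic_relations (S # map U [1..<Suc n]) \<union>
    (\<Union>i\<in>{1..m}. \<Union>j\<in>{1..n}. cyclic_relations [T i, U j])"

definition G_plus :: "nat \<Rightarrow> nat \<Rightarrow> letter list set monoid" where
  "G_plus m n = presented_monoid (letters m n) (G_relations m n)"

definition G_word :: "nat \<Rightarrow> nat \<Rightarrow> letter list \<Rightarrow> letter list set" where
  "G_word m n w = word_class (letters m n) (G_relations m n) w"

definition L0 :: "nat \<Rightarrow> nat \<Rightarrow> letter list set set" where
  "L0 m n = (\<lambda>x. G_word m n [x]) ` letters m n"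

definition Delta :: "nat \<Rightarrow> nat \<Rightarrow> letter list set" where
  "Delta m n = G_word m n ([S] @ map T [1..<Suc m] @ map U [1..<Suc n])"

text \<open>The generators stay pairwise distinct in the monoid, so permutations of \<open>L0 m n\<close> are the
  same thing as permutations of the letters. This needs every relator to have length at least 2,
  hence \<open>m, n \<ge> 1\<close>.\<close>

lemma inj_on_generators:
  assumes "m \<ge> 1" "n \<ge> 1"
  shows "inj_on (\<lambda>x. G_word m n [x]) (letters m n)"
proof -
  have R: "length u = length v \<and> length u \<ge> 2" if uv: "(u, v) \<in> G_relations m n" for u v
  proof -
    from uv obtain w where w: "(u, v) \<in> cyclic_relations w"
      and "w = S # map T [1..<Suc m] \<or> w = S # map U [1..<Suc n] \<or> (\<exists>i j. w = [T i, U j])"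
      unfolding G_relations_def by blast
    then have "length w \<ge> 2"
      using assms by (elim disjE exE) simp_all
    moreover have "length u = length w" "length v = length w"
      using w unfolding cyclic_relations_def by (blast intro: length_rotate)+
    ultimately show ?thesis by simp
  qed
  have *: "length u = length v \<and> (length u \<le> 1 \<longrightarrow> u = v)"
    if "(u, v) \<in> word_cong (letters m n) (G_relations m n)" for u v
    using that
  proof (induction rule: word_cong.induct)
    case (base u v)
    then show ?case
      using R[of u v] by linarith
  next
    case (append u u' v v')
    then have len: "length u = length u'" "length v = length v'"
      by blast+
    have "u = u' \<and> v = v'" if "length (u @ v) \<le> 1"
    proof -
      from that have "length u \<le> 1" "length v \<le> 1" by simp_all
      then show ?thesis using append.IH by blast
    qed
    then show ?case using len by (metis length_append)
  next
    case (trans u v w)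
    then show ?case by metis
  next
    case (sym u v)
    then show ?case by metis
  qed blast
  show ?thesis
  proof (rule inj_onI)
    fix x y
    assume "x \<in> letters m n" "y \<in> letters m n" "G_word m n [x] = G_word m n [y]"
    then have "([x], [y]) \<in> word_cong (letters m n) (G_relations m n)"
      by (simp add: G_word_def word_class_eq_iff)
    then have "[x] = [y]"
      using *[of "[x]" "[y]"] by (metis length_Cons list.size(3) One_nat_def order_refl)
    then show "x = y" by simp
  qed
qed

end

theory Submission imports Defs begin

text \<open>\<open>\<Delta>\<close> is central, so \<open>\<sigma>\<^sub>\<Delta>\<close> can be taken to be the identity. Put
  \<open>T = t\<^sub>1 \<dots> t\<^sub>m\<close> and \<open>U = u\<^sub>1 \<dots> u\<^sub>n\<close>. Every letter \<open>x\<close> of \<open>s T\<close> commutes with \<open>U\<close>, and rotating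
  \<open>s T\<close> to \<open>x p = p x\<close> gives \<open>\<Delta> = x (p U) = (p U) x\<close>. Since \<open>U\<close> commutes with \<open>T\<close>, also
  \<open>\<Delta> = s U T\<close>, so the letters of \<open>U\<close> are treated in the same way.\<close>

lemma word_cong_append_same:
  assumes "(u, v) \<in> word_cong X R" "a \<in> lists X" "b \<in> lists X"
  shows "(a @ u @ b, a @ v @ b) \<in> word_cong X R"
  using assms by (intro word_cong.append word_cong.refl)

text \<open>Cutting a relator at any point and swapping the two pieces is one of its cyclic
  rotations, namely the one by \<open>length a\<close>.\<close>

lemma word_cong_rotate:
  assumes "cyclic_relations (a @ b) \<subseteq> R" "a \<in> lists X" "b \<in> lists X"
  shows "(a @ b, b @ a) \<in> word_cong X R"
proof (rule word_cong.base)
  have "a @ b = rotate 0 (a @ b)" "b @ a = rotate (length a) (a @ b)"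
    by (simp_all add: rotate_append)
  then have "(a @ b, b @ a) \<in> cyclic_relations (a @ b)"
    unfolding cyclic_relations_def by blast
  then show "(a @ b, b @ a) \<in> R" using assms by blast
qed (use assms in auto)

text \<open>\<open>a\<close> moves past \<open>b\<close>, then past \<open>c\<close>. The bracketing
  \<open>(b @ c) @ a\<close> keeps the shape of a commutation, so that the result can be iterated
  over a list.\<close>

lemma word_cong_commute_append:
  assumes "(a @ b, b @ a) \<in> word_cong X R" "(a @ c, c @ a) \<in> word_cong X R"
  shows "(a @ b @ c, (b @ c) @ a) \<in> word_cong X R"
proof -
  have abc: "a \<in> lists X" "b \<in> lists X" "c \<in> lists X"
    using assms[THEN word_cong_in_lists] by auto
  have "(a @ b @ c, b @ a @ c) \<in> word_cong X R"
    using word_cong_append_same[OF assms(1), of "[]" c] abc by simp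
  moreover have "(b @ a @ c, b @ c @ a) \<in> word_cong X R"
    using word_cong_append_same[OF assms(2), of b "[]"] abc by simp
  ultimately show ?thesis by (auto intro: word_cong.trans)
qed

lemma word_cong_commute_list:
  assumes "a \<in> lists X" "\<And>y. y \<in> set b \<Longrightarrow> (a @ [y], [y] @ a) \<in> word_cong X R"
  shows "(a @ b, b @ a) \<in> word_cong X R"
  using assms(2)
proof (induction b)
  case Nil
  then show ?case using assms(1) by (simp add: word_cong.refl)
next
  case (Cons y b)
  then show ?case using word_cong_commute_append[of a "[y]" X R b] by simp
qed

text \<open>If \<open>w = c x d\<close>, rotation turns \<open>w\<close> into both
  \<open>x d c\<close> and \<open>d c x\<close>. In the second case \<open>x\<close> still has to
  pass the remaining block \<open>b\<close>, which \<open>comm\<close> permits. So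
  \<open>p = d c b\<close> serves on both sides.\<close>

lemma word_cong_split_letter:
  assumes "x \<in> set w" "cyclic_relations w \<subseteq> R" "w \<in> lists X"
    and comm: "([x] @ b, b @ [x]) \<in> word_cong X R"
  shows "\<exists>p\<in>lists X. (w @ b, [x] @ p) \<in> word_cong X R \<and> (w @ b, p @ [x]) \<in> word_cong X R"
proof -
  obtain c d where w: "w = c @ x # d"
    using assms(1) by (meson split_list)
  have X: "x \<in> X" "c \<in> lists X" "d \<in> lists X" "b \<in> lists X"
    using assms(3) word_cong_in_lists[OF comm] by (auto simp: w)
  \<comment> \<open>Cut just before \<open>x\<close>; the later rotation cuts just after it.\<close>
  have "(w, [x] @ d @ c) \<in> word_cong X R"
    using word_cong_rotate[of c "x # d"] assms X by (simp add: w)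
  from word_cong_append_same[OF this, of "[]" b]
  have 1: "(w @ b, [x] @ d @ c @ b) \<in> word_cong X R"
    using X by simp
  have "(w, (d @ c) @ [x]) \<in> word_cong X R"
    using word_cong_rotate[of "c @ [x]" d] assms X by (simp add: w)
  from word_cong_append_same[OF this, of "[]" b]
  have 2: "(w @ b, d @ c @ [x] @ b) \<in> word_cong X R"
    using X by simp
  have 3: "(d @ c @ [x] @ b, d @ c @ b @ [x]) \<in> word_cong X R"
    using word_cong_append_same[OF comm, of "d @ c" "[]"] X by simp
  from 1 word_cong.trans[OF 2 3] X show ?thesis
    by (intro bexI[of _ "d @ c @ b"]) auto
qed

lemma letter_Delta_split:
  assumes "x \<in> letters m n"
  shows "\<exists>p\<in>lists (letters m n).
    (S # map T [1..<Suc m] @ map U [1..<Suc n], [x] @ p) \<in> word_cong (letters m n) (G_relations m n) \<and>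
    (S # map T [1..<Suc m] @ map U [1..<Suc n], p @ [x]) \<in> word_cong (letters m n) (G_relations m n)"
proof -
  define X where "X = letters m n"
  define R where "R = G_relations m n"
  define t where "t = map T [1..<Suc m]"
  define u where "u = map U [1..<Suc n]"
  have set_t: "set t = T ` {1..m}" and set_u: "set u = U ` {1..n}"
    by (auto simp: t_def u_def)
  have lists: "S \<in> X" "t \<in> lists X" "u \<in> lists X"
    by (auto simp: X_def letters_def set_t set_u in_lists_conv_set)
  have R_t: "cyclic_relations (S # t) \<subseteq> R" and R_u: "cyclic_relations (S # u) \<subseteq> R"
    unfolding R_def G_relations_def t_def u_def by blast+
  \<comment> \<open>This is the relator \<open>S # u\<close> cut after its first letter.\<close>
  have S_u: "([S] @ u, u @ [S]) \<in> word_cong X R"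
    using word_cong_rotate[of "[S]"] R_u lists by auto
  have t_u_letters: "([x] @ [y], [y] @ [x]) \<in> word_cong X R" if "x \<in> set t" "y \<in> set u" for x y
  proof (rule word_cong_rotate)
    show "cyclic_relations ([x] @ [y]) \<subseteq> R"
      using that unfolding R_def G_relations_def by (auto simp: set_t set_u)
  qed (use that lists in auto)
  have t_letter_u: "([x] @ u, u @ [x]) \<in> word_cong X R" if "x \<in> set t" for x
    using that lists by (intro word_cong_commute_list[OF _ t_u_letters]) auto
  have u_letter_t: "([y] @ t, t @ [y]) \<in> word_cong X R" if "y \<in> set u" for y
    using that lists by (intro word_cong_commute_list[OF _ word_cong.sym[OF t_u_letters]]) auto
  \<comment> \<open>Second lift: from letter past block to block past block.\<close>
  have u_t: "(t @ u, u @ t) \<in> word_cong X R"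
    using lists by (intro word_cong_commute_list[OF _ word_cong.sym[OF u_letter_t]]) auto
  have swap: "(S # t @ u, S # u @ t) \<in> word_cong X R"
    using word_cong_append_same[OF u_t, of "[S]" "[]"] lists by simp
  have "x \<in> set (S # t) \<or> x \<in> set u"
    using assms by (auto simp: letters_def set_t set_u)
  then have "\<exists>p\<in>lists X. (S # t @ u, [x] @ p) \<in> word_cong X R \<and>
      (S # t @ u, p @ [x]) \<in> word_cong X R"
  proof
    assume x: "x \<in> set (S # t)"
    then have "([x] @ u, u @ [x]) \<in> word_cong X R"
      using S_u t_letter_u by auto
    then show ?thesis
      using word_cong_split_letter[OF x R_t] lists by simp
  next
    assume x: "x \<in> set u"
    \<comment> \<open>Here \<open>S # u\<close> is the rotated block and \<open>t\<close> the one
      that \<open>x\<close> passes.\<close>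
    then have "\<exists>p\<in>lists X. (S # u @ t, [x] @ p) \<in> word_cong X R \<and>
        (S # u @ t, p @ [x]) \<in> word_cong X R"
      using word_cong_split_letter[OF _ R_u _ u_letter_t] lists by simp
    then show ?thesis
      using swap by (blast intro: word_cong.trans)
  qed
  then show ?thesis
    by (simp only: X_def R_def t_def u_def)
qed

theorem proposition3p1:
  fixes m n :: nat
  assumes "m \<ge> 2" and "n \<ge> 2"
  shows "fundamental_element (G_plus m n) (L0 m n) (Delta m n)"
proof -
  let ?X = "letters m n" and ?R = "G_relations m n"
  let ?w = "S # map T [1..<Suc m] @ map U [1..<Suc n]"
  have w: "?w \<in> lists ?X"
    by (auto simp: letters_def in_lists_conv_set)
  have Delta: "Delta m n = word_class ?X ?R ?w"
    by (simp add: Delta_def G_word_def)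
  \<comment> \<open>Writing \<open>id v\<close> makes the identity visible as the witness for the
    permutation.\<close>
  have "\<exists>D\<in>carrier (G_plus m n).
      Delta m n = v \<otimes>\<^bsub>G_plus m n\<^esub> D \<and> Delta m n = D \<otimes>\<^bsub>G_plus m n\<^esub> id v"
    if "v \<in> L0 m n" for v
  proof -
    obtain x where x: "x \<in> ?X" "v = word_class ?X ?R [x]"
      using \<open>v \<in> L0 m n\<close> by (auto simp: L0_def G_word_def)
    obtain p where p: "p \<in> lists ?X" "(?w, [x] @ p) \<in> word_cong ?X ?R"
      "(?w, p @ [x]) \<in> word_cong ?X ?R"
      using letter_Delta_split[OF x(1)] by blast
    have "Delta m n = word_class ?X ?R ([x] @ p)" "Delta m n = word_class ?X ?R (p @ [x])"
      unfolding Delta using p x w by (subst word_class_eq_iff; simp)+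
    then show ?thesis
      using p(1) x
      by (intro bexI[of _ "word_class ?X ?R p"])
        (simp_all add: G_plus_def mult_word_class word_class_in_carrier)
  qed
  moreover have "Delta m n \<in> carrier (G_plus m n)"
    unfolding Delta G_plus_def using w by (rule word_class_in_carrier)
  ultimately show ?thesis
    unfolding fundamental_element_def using permutes_id[of "L0 m n"] by blast
qed

end
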